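(* Let $M=M_1\coprod M_2$ be the metric sum of two pointed metric spaces $M_1$ and $M_2$, and let $Y$ be a Banach space. If the pair $(M,Y)$ has the Lip-BPB property for Lipschitz compact maps, then so do $(M_1,Y)$ and $(M_2,Y)$.
   Context: All metric spaces are complete and all Banach spaces are real. A pointed metric space is a metric space $(M,d)$ with a distinguished point $0\in M$. For a Banach space $Y$, $\mathrm{Lip}_0(M,Y)$ is the Banach space of Lipschitz maps $F\colon M\to Y$ with $F(0)=0$, with the norm $\|F\|_L=\sup\{\|F(p)-F(q)\|/d(p,q)\colon p,q\in M,\ p\neq q\}$. A map $F\in \mathrm{Lip}_0(M,Y)$ is Lipschitz compact if the set $\{(F(p)-F(q))/d(p,q)\colon p,q\in M,\ p\neq q\}$ is relatively compact in $Y$; $\mathrm{Lip}_{0K}(M,Y)$ denotes the space of such maps. The pair $(M,Y)$ has the Lip-BPB property for Lipschitz compact maps if for every $\varepsilon>0$ there is $\eta(\varepsilon)>0$ such that for every $F\in\mathrm{Lip}_{0K}(M,Y)$ with $\|F\|_L=1$ and all $p\neq q$ in $M$ with $\|F(p)-F(q)\|>(1-\eta(\varepsilon))\,d(p,q)$, there exist $G\in\mathrm{Lip}_{0K}(M,Y)$ and $r\neq s$ in $M$ such that $$\frac{\|G(r)-G(s)\|}{d(r,s)}=\|G\|_L=1,\qquad \|G-F\|_L<\varepsilon,\qquad \frac{d(p,r)+d(q,s)}{d(p,q)}<\varepsilon.$$ The (metric) sum $M_1\coprod M_2$ of pointed metric spaces $(M_1,d_1)$, $(M_2,d_2)$ is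 their disjoint union with the base points identified to one point $0$ (the base point), with the metric $d(x,y)=d_i(x,y)$ if $x,y\in M_i$, and $d(x,y)=d_i(x,0)+d_j(0,y)$ if $x\in M_i$, $y\in M_j$, $i\neq j$. *)

theory Defs
  imports "HOL-Analysis.Analysis"
begin

text \<open>
  A pointed metric space is a library metric \<open>M :: 'a metric\<close> together with a point
  \<open>z \<in> mspace M\<close>; the Banach space \<open>Y\<close> is a type of class \<open>banach\<close>.
  Maps on \<open>M\<close> are total functions on \<open>'a\<close>; none of the notions below depends on their values
  outside \<open>mspace M\<close>.
\<close>

definition slopes :: "'a metric \<Rightarrow> ('a \<Rightarrow> 'y::banach) \<Rightarrow> 'y set"
  where "slopes M F =
    {(F p - F q) /\<^sub>R mdist M p q | p q. p \<in> mspace M \<and> q \<in> mspace M \<and> p \<noteq> q}"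

definition Lip0 :: "'a metric \<Rightarrow> 'a \<Rightarrow> ('a \<Rightarrow> 'y::banach) set"
  where "Lip0 M z = {F. Lipschitz_continuous_map M euclidean_metric F \<and> F z = 0}"

text \<open>
  Inserting \<open>0\<close> affects only a one-point space, where the supremum over the empty set has to be
  \<open>0\<close>. On \<open>real\<close>, \<open>Sup\<close> is meaningful only for bounded sets, hence the norm only for
  Lipschitz maps.
\<close>

definition Lip_norm :: "'a metric \<Rightarrow> ('a \<Rightarrow> 'y::banach) \<Rightarrow> real"
  where "Lip_norm M F = Sup (insert 0
    {norm (F p - F q) / mdist M p q | p q. p \<in> mspace M \<and> q \<in> mspace M \<and> p \<noteq> q})"

definition Lip0K :: "'a metric \<Rightarrow> 'a \<Rightarrow> ('a \<Rightarrow> 'y::banach) set"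
  where "Lip0K M z = {F \<in> Lip0 M z. compact (closure (slopes M F))}"

definition Lip_BPB_compact :: "'a metric \<Rightarrow> 'a \<Rightarrow> 'y::banach itself \<Rightarrow> bool"
  where "Lip_BPB_compact M z (Y :: 'y itself) \<longleftrightarrow>
    (\<forall>\<epsilon>>0. \<exists>\<eta>>0. \<forall>F \<in> (Lip0K M z :: ('a \<Rightarrow> 'y) set). \<forall>p \<in> mspace M. \<forall>q \<in> mspace M.
      Lip_norm M F = 1 \<longrightarrow> p \<noteq> q \<longrightarrow> norm (F p - F q) > (1 - \<eta>) * mdist M p q \<longrightarrow>
      (\<exists>G \<in> (Lip0K M z :: ('a \<Rightarrow> 'y) set). \<exists>r \<in> mspace M. \<exists>s \<in> mspace M. r \<noteq> s \<and>
        norm (G r - G s) / mdist M r s = Lip_norm M G \<and> Lip_norm M G = 1 \<and>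
        Lip_norm M (\<lambda>x. G x - F x) < \<epsilon> \<and>
        (mdist M p r + mdist M q s) / mdist M p q < \<epsilon>))"

text \<open>
  The common base point of the metric sum is represented by \<open>Inl z1\<close>, so the copy \<open>Inr z2\<close> is
  left out of the carrier. The mixed clauses of the distance remain correct for \<open>Inl z1\<close>,
  since \<open>mdist M1 z1 z1 = 0\<close>.
\<close>

definition sum_carrier :: "'a metric \<Rightarrow> 'a \<Rightarrow> 'b metric \<Rightarrow> 'b \<Rightarrow> ('a + 'b) set"
  where "sum_carrier M1 z1 M2 z2 = Inl ` mspace M1 \<union> Inr ` (mspace M2 - {z2})"

fun sum_dist :: "'a metric \<Rightarrow> 'a \<Rightarrow> 'b metric \<Rightarrow> 'b \<Rightarrow> 'a + 'b \<Rightarrow> 'a + 'b \<Rightarrow> real"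
  where
    "sum_dist M1 z1 M2 z2 (Inl x) (Inl y) = mdist M1 x y"
  | "sum_dist M1 z1 M2 z2 (Inr x) (Inr y) = mdist M2 x y"
  | "sum_dist M1 z1 M2 z2 (Inl x) (Inr y) = mdist M1 x z1 + mdist M2 z2 y"
  | "sum_dist M1 z1 M2 z2 (Inr x) (Inl y) = mdist M2 x z2 + mdist M1 z1 y"

definition metric_sum :: "'a metric \<Rightarrow> 'a \<Rightarrow> 'b metric \<Rightarrow> 'b \<Rightarrow> ('a + 'b) metric"
  where "metric_sum M1 z1 M2 z2 = metric (sum_carrier M1 z1 M2 z2, sum_dist M1 z1 M2 z2)"

lemma Metric_space_sum:
  assumes z1: "z1 \<in> mspace M1" and z2: "z2 \<in> mspace M2"
  shows "Metric_space (sum_carrier M1 z1 M2 z2) (sum_dist M1 z1 M2 z2)"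
proof
  fix x y :: "'a + 'b"
  show "0 \<le> sum_dist M1 z1 M2 z2 x y"
    by (cases x; cases y) auto
  show "sum_dist M1 z1 M2 z2 x y = sum_dist M1 z1 M2 z2 y x"
    by (cases x; cases y) (auto simp: mdist_commute)
next
  fix x y
  assume "x \<in> sum_carrier M1 z1 M2 z2" "y \<in> sum_carrier M1 z1 M2 z2"
  then show "(sum_dist M1 z1 M2 z2 x y = 0) = (x = y)"
    using z1 z2 by (cases x; cases y) (auto simp: sum_carrier_def add_nonneg_eq_0_iff)
next
  fix x y z
  assume xyz: "x \<in> sum_carrier M1 z1 M2 z2" "y \<in> sum_carrier M1 z1 M2 z2"
    "z \<in> sum_carrier M1 z1 M2 z2"
  have t1: "mdist M1 a c \<le> mdist M1 a b + mdist M1 b c"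
    if "a \<in> mspace M1" "b \<in> mspace M1" "c \<in> mspace M1" for a b c
    using that by (rule mdist_triangle)
  have t2: "mdist M2 a c \<le> mdist M2 a b + mdist M2 b c"
    if "a \<in> mspace M2" "b \<in> mspace M2" "c \<in> mspace M2" for a b c
    using that by (rule mdist_triangle)
  have nn: "0 \<le> mdist M1 a b" "0 \<le> mdist M2 c d" for a b c d by auto
  show "sum_dist M1 z1 M2 z2 x z \<le> sum_dist M1 z1 M2 z2 x y + sum_dist M1 z1 M2 z2 y z"
    using xyz z1 z2
    by (cases x; cases y; cases z)
      (auto simp: sum_carrier_def intro: t1 t2,
       (smt (verit) t1 t2 nn mdist_commute)+)
qed

lemma mspace_metric_sum:
  assumes "z1 \<in> mspace M1" and "z2 \<in> mspace M2"
  shows "mspace (metric_sum M1 z1 M2 z2) = sum_carrier M1 z1 M2 z2"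
  using Metric_space.mspace_metric[OF Metric_space_sum[OF assms]] by (simp add: metric_sum_def)

lemma mdist_metric_sum:
  assumes "z1 \<in> mspace M1" and "z2 \<in> mspace M2"
  shows "mdist (metric_sum M1 z1 M2 z2) = sum_dist M1 z1 M2 z2"
  using Metric_space.mdist_metric[OF Metric_space_sum[OF assms]] by (simp add: metric_sum_def)

end

theory Submission
  imports Defs
begin

text \<open>
  A nonexpansive base-point preserving map \<open>h\<close> induces the operator \<open>F \<mapsto> F \<circ> h\<close>, which does not
  increase the Lipschitz norm and preserves Lipschitz compactness. Each summand embeds isometrically
  into the sum and is a nonexpansive retract of it, so a map \<open>F\<close> on the summand extends to the sum,
  with the same norm, by \<open>0\<close> on the other summand. Let \<open>G\<close> be a norm-one approximation of the
  extension within \<open>\<epsilon> \<le> 1\<close> that attains its norm at a pair \<open>(r, s)\<close>. On the other summand the slopes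
  of \<open>G\<close> are smaller than \<open>1\<close>, and a pair from different summands that attains the norm would, by
  additivity of the metric through the base point, force slope \<open>1\<close> there. Hence \<open>r\<close> and \<open>s\<close> lie in
  the given summand, and the restriction of \<open>G\<close> is the required map.
\<close>

lemma mdist_gt_zero: "x \<noteq> y \<Longrightarrow> x \<in> mspace M \<Longrightarrow> y \<in> mspace M \<Longrightarrow> 0 < mdist M x y"
  by (rule Metric_space.mdist_pos_less[OF Metric_space_mspace_mdist])

text \<open>Real \<open>Sup\<close> dominates the members of a set only when that set is bounded
  above, so every estimate of a slope by \<open>Lip_norm\<close> goes through this bound.\<close>

lemma Lip_norm_bdd_above:
  assumes "Lipschitz_continuous_map M euclidean_metric F"
  shows "bdd_above (insert 0
    {norm (F p - F q) / mdist M p q | p q. p \<in> mspace M \<and> q \<in> mspace M \<and> p \<noteq> q})"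
proof -
  obtain B where B: "\<And>x y. x \<in> mspace M \<Longrightarrow> y \<in> mspace M \<Longrightarrow> dist (F x) (F y) \<le> B * mdist M x y"
    using assms unfolding Lipschitz_continuous_map_def by auto
  \<comment> \<open>The constant \<open>B\<close> may be negative, for instance on a one-point
    space, while the bound must also dominate the inserted \<open>0\<close>; hence the absolute
    value.\<close>
  have "norm (F p - F q) / mdist M p q \<le> \<bar>B\<bar>" if "p \<in> mspace M" "q \<in> mspace M" "p \<noteq> q" for p q
  proof -
    have "0 < mdist M p q"
      using that by (intro mdist_gt_zero)
    moreover have "norm (F p - F q) \<le> \<bar>B\<bar> * mdist M p q"
      using B[OF that(1,2)] mult_right_mono[OF abs_ge_self[of B] mdist_nonneg[of M p q]]
      by (simp add: dist_norm)
    ultimately show ?thesis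
      by (simp add: divide_le_eq)
  qed
  then show ?thesis
    by (intro bdd_aboveI[of _ "\<bar>B\<bar>"]) auto
qed

lemma Lip_norm_nonneg:
  "Lipschitz_continuous_map M euclidean_metric F \<Longrightarrow> 0 \<le> Lip_norm M F"
  unfolding Lip_norm_def by (intro cSup_upper Lip_norm_bdd_above) auto

lemma norm_diff_le_Lip_norm:
  assumes F: "Lipschitz_continuous_map M euclidean_metric F"
    and pq: "p \<in> mspace M" "q \<in> mspace M"
  shows "norm (F p - F q) \<le> Lip_norm M F * mdist M p q"
proof (cases "p = q")
  case False
  then have "norm (F p - F q) / mdist M p q \<le> Lip_norm M F"
    unfolding Lip_norm_def using pq by (intro cSup_upper Lip_norm_bdd_above[OF F]) auto
  moreover have "0 < mdist M p q"
    using False pq by (rule mdist_gt_zero)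
  ultimately show ?thesis
    by (simp add: divide_le_eq)
qed (use Lip_norm_nonneg[OF F] in simp)

lemma Lip_norm_le:
  assumes "0 \<le> K"
    and "\<And>p q. p \<in> mspace M \<Longrightarrow> q \<in> mspace M \<Longrightarrow> norm (F p - F q) \<le> K * mdist M p q"
  shows "Lip_norm M F \<le> K"
proof -
  have "norm (F p - F q) / mdist M p q \<le> K" if "p \<in> mspace M" "q \<in> mspace M" "p \<noteq> q" for p q
    using assms(2)[OF that(1,2)] mdist_gt_zero[OF that(3,1,2)] by (simp add: divide_le_eq)
  then show ?thesis
    unfolding Lip_norm_def using assms(1) by (intro cSup_least) auto
qed

lemma Lipschitz_continuous_map_diff:
  fixes F G :: "'a \<Rightarrow> 'y::real_normed_vector"
  assumes "Lipschitz_continuous_map M euclidean_metric F"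
    and "Lipschitz_continuous_map M euclidean_metric G"
  shows "Lipschitz_continuous_map M euclidean_metric (\<lambda>x. F x - G x)"
proof -
  obtain B where B: "\<And>x y. x \<in> mspace M \<Longrightarrow> y \<in> mspace M \<Longrightarrow> dist (F x) (F y) \<le> B * mdist M x y"
    using assms(1) unfolding Lipschitz_continuous_map_def by auto
  obtain C where C: "\<And>x y. x \<in> mspace M \<Longrightarrow> y \<in> mspace M \<Longrightarrow> dist (G x) (G y) \<le> C * mdist M x y"
    using assms(2) unfolding Lipschitz_continuous_map_def by auto
  have "dist (F x - G x) (F y - G y) \<le> (B + C) * mdist M x y"
    if "x \<in> mspace M" "y \<in> mspace M" for x y
    using B[OF that] C[OF that] norm_diff_triangle_ineq[of "F x" "- G x" "F y" "- G y"]
    by (simp add: dist_norm distrib_right norm_minus_commute)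
  then show ?thesis
    unfolding Lipschitz_continuous_map_def by auto
qed

lemma Lip_norm_comp_le:
  assumes F: "Lipschitz_continuous_map N euclidean_metric F"
    and h: "h \<in> mspace M \<rightarrow> mspace N"
    and ne: "\<And>x y. x \<in> mspace M \<Longrightarrow> y \<in> mspace M \<Longrightarrow> mdist N (h x) (h y) \<le> mdist M x y"
  shows "Lip_norm M (\<lambda>x. F (h x)) \<le> Lip_norm N F"
proof (rule Lip_norm_le[OF Lip_norm_nonneg[OF F]])
  fix p q
  assume pq: "p \<in> mspace M" "q \<in> mspace M"
  have "norm (F (h p) - F (h q)) \<le> Lip_norm N F * mdist N (h p) (h q)"
    using pq h by (intro norm_diff_le_Lip_norm[OF F]) auto
  also have "\<dots> \<le> Lip_norm N F * mdist M p q"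
    by (intro mult_left_mono ne pq Lip_norm_nonneg[OF F])
  finally show "norm (F (h p) - F (h q)) \<le> Lip_norm N F * mdist M p q" .
qed

text \<open>A slope of \<open>F \<circ> h\<close> is \<open>0\<close> if \<open>h\<close> collapses
  the pair, and otherwise a slope of \<open>F\<close> scaled by a factor in [0,1], because
  \<open>h\<close> is nonexpansive. All slopes thus lie in the continuous image of a product of two
  compact sets.\<close>

lemma Lip0K_comp:
  fixes F :: "'b \<Rightarrow> 'y::banach"
  assumes F: "F \<in> Lip0K N w"
    and h: "h \<in> mspace M \<rightarrow> mspace N"
    and ne: "\<And>x y. x \<in> mspace M \<Longrightarrow> y \<in> mspace M \<Longrightarrow> mdist N (h x) (h y) \<le> mdist M x y"
    and hz: "h z = w"
  shows "(\<lambda>x. F (h x)) \<in> Lip0K M z"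
proof -
  have LF: "Lipschitz_continuous_map N euclidean_metric F" and "F w = 0"
    and cF: "compact (closure (slopes N F))"
    using F by (auto simp: Lip0K_def Lip0_def)
  have "Lipschitz_continuous_map M N h"
    unfolding Lipschitz_continuous_map_def using h ne by (auto intro!: exI[of _ 1])
  from Lipschitz_continuous_map_compose[OF this LF]
  have LFh: "Lipschitz_continuous_map M euclidean_metric (\<lambda>x. F (h x))"
    by (simp add: comp_def)
  \<comment> \<open>The inserted \<open>0\<close> covers the collapsed pairs even when
    \<open>slopes N F\<close> is empty.\<close>
  define K where "K = (\<lambda>(t, y). t *\<^sub>R y) ` ({0..1::real} \<times> insert 0 (closure (slopes N F)))"
  have "compact K"
    unfolding K_def
    by (intro compact_continuous_image compact_Times compact_Icc compact_insert cF)
      (auto simp: case_prod_unfold intro!: continuous_intros)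
  have "slopes M (\<lambda>x. F (h x)) \<subseteq> K"
  proof
    fix v
    assume "v \<in> slopes M (\<lambda>x. F (h x))"
    then obtain p q where pq: "p \<in> mspace M" "q \<in> mspace M" "p \<noteq> q"
      and v: "v = (F (h p) - F (h q)) /\<^sub>R mdist M p q"
      by (auto simp: slopes_def)
    have hpq: "h p \<in> mspace N" "h q \<in> mspace N"
      using h pq by auto
    show "v \<in> K"
    proof (cases "h p = h q")
      case True
      then show ?thesis
        unfolding K_def v by (intro image_eqI[of _ _ "(0, 0)"]) auto
    next
      case False
      have pos: "0 < mdist M p q" "0 < mdist N (h p) (h q)"
        using pq hpq False by (auto intro: mdist_gt_zero)
      let ?t = "mdist N (h p) (h q) / mdist M p q"
      let ?u = "(F (h p) - F (h q)) /\<^sub>R mdist N (h p) (h q)"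
      have "?u \<in> closure (slopes N F)"
        using hpq False by (intro subsetD[OF closure_subset]) (auto simp: slopes_def)
      moreover have "?t \<in> {0..1}"
        using ne[OF pq(1,2)] pos by (auto simp: divide_le_eq)
      moreover have "v = ?t *\<^sub>R ?u"
        using pos by (simp add: v field_simps)
      ultimately show ?thesis
        unfolding K_def by (intro image_eqI[of _ _ "(?t, ?u)"]) auto
    qed
  qed
  then have "closure (slopes M (\<lambda>x. F (h x))) \<subseteq> K"
    by (intro closure_minimal compact_imp_closed \<open>compact K\<close>)
  then have "compact (closure (slopes M (\<lambda>x. F (h x))))"
    using compact_Int_closed[OF \<open>compact K\<close> closed_closure] by (metis inf.absorb2)
  then show ?thesis
    using LFh \<open>F w = 0\<close> hz by (simp add: Lip0K_def Lip0_def)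
qed

text \<open>\<open>metric_sum\<close> treats its summands asymmetrically at the base point. Stating
  the argument for an embedding \<open>j\<close> and a retraction \<open>\<rho>\<close> that
  collapses the rest of \<open>N\<close> to the base point lets one proof serve both
  summands.\<close>

lemma Lip_BPB_compact_retract:
  fixes j :: "'a \<Rightarrow> 'b" and \<rho> :: "'b \<Rightarrow> 'a"
  assumes w: "w \<in> mspace N"
    and j: "j \<in> mspace M \<rightarrow> mspace N" "j z = w"
    and iso: "\<And>x y. x \<in> mspace M \<Longrightarrow> y \<in> mspace M \<Longrightarrow> mdist N (j x) (j y) = mdist M x y"
    and \<rho>: "\<rho> \<in> mspace N \<rightarrow> mspace M" "\<rho> w = z"
    and ne: "\<And>x y. x \<in> mspace N \<Longrightarrow> y \<in> mspace N \<Longrightarrow> mdist M (\<rho> x) (\<rho> y) \<le> mdist N x y"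
    and \<rho>j: "\<And>x. x \<in> mspace M \<Longrightarrow> \<rho> (j x) = x"
    and \<rho>z: "\<And>y. y \<in> mspace N \<Longrightarrow> y \<notin> j ` mspace M \<Longrightarrow> \<rho> y = z"
    and add: "\<And>x y. x \<in> mspace M \<Longrightarrow> y \<in> mspace N \<Longrightarrow> y \<notin> j ` mspace M \<Longrightarrow>
      mdist N (j x) y = mdist N (j x) w + mdist N w y"
    and BPB: "Lip_BPB_compact N w TYPE('y::banach)"
  shows "Lip_BPB_compact M z TYPE('y)"
  unfolding Lip_BPB_compact_def
proof (intro allI impI)
  fix \<epsilon> :: real
  assume "\<epsilon> > 0"
  \<comment> \<open>The cap \<open>1\<close> makes the slopes of \<open>G\<close> outside the copy
    of \<open>M\<close> strictly smaller than \<open>1\<close>.\<close>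
  then have "min \<epsilon> 1 > 0" by simp
  from BPB[unfolded Lip_BPB_compact_def, THEN spec, THEN mp, OF this]
  obtain \<eta> where "\<eta> > 0" and \<eta>: "\<forall>F \<in> (Lip0K N w :: ('b \<Rightarrow> 'y) set).
      \<forall>p \<in> mspace N. \<forall>q \<in> mspace N.
      Lip_norm N F = 1 \<longrightarrow> p \<noteq> q \<longrightarrow> norm (F p - F q) > (1 - \<eta>) * mdist N p q \<longrightarrow>
      (\<exists>G \<in> (Lip0K N w :: ('b \<Rightarrow> 'y) set). \<exists>r \<in> mspace N. \<exists>s \<in> mspace N. r \<noteq> s \<and>
        norm (G r - G s) / mdist N r s = Lip_norm N G \<and> Lip_norm N G = 1 \<and>
        Lip_norm N (\<lambda>x. G x - F x) < min \<epsilon> 1 \<and>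
        (mdist N p r + mdist N q s) / mdist N p q < min \<epsilon> 1)"
    by (elim exE conjE) (rule that)
  show "\<exists>\<eta>>0. \<forall>F \<in> (Lip0K M z :: ('a \<Rightarrow> 'y) set). \<forall>p \<in> mspace M. \<forall>q \<in> mspace M.
      Lip_norm M F = 1 \<longrightarrow> p \<noteq> q \<longrightarrow> norm (F p - F q) > (1 - \<eta>) * mdist M p q \<longrightarrow>
      (\<exists>G \<in> (Lip0K M z :: ('a \<Rightarrow> 'y) set). \<exists>r \<in> mspace M. \<exists>s \<in> mspace M. r \<noteq> s \<and>
        norm (G r - G s) / mdist M r s = Lip_norm M G \<and> Lip_norm M G = 1 \<and>
        Lip_norm M (\<lambda>x. G x - F x) < \<epsilon> \<and>
        (mdist M p r + mdist M q s) / mdist M p q < \<epsilon>)"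
  proof (intro exI conjI ballI impI)
    show "\<eta> > 0" by fact
  next
    fix F :: "'a \<Rightarrow> 'y" and p q
    assume F: "F \<in> Lip0K M z" and p: "p \<in> mspace M" and q: "q \<in> mspace M"
      and F1: "Lip_norm M F = 1" and "p \<noteq> q"
      and big: "norm (F p - F q) > (1 - \<eta>) * mdist M p q"
    have j_ne: "mdist N (j x) (j y) \<le> mdist M x y" if "x \<in> mspace M" "y \<in> mspace M" for x y
      using iso[OF that] by simp
    have Lip: "Lipschitz_continuous_map L euclidean_metric H" if "H \<in> Lip0K L u"
      for L :: "'c metric" and H :: "'c \<Rightarrow> 'y" and u
      using that by (simp add: Lip0K_def Lip0_def)
    let ?F = "\<lambda>x. F (\<rho> x)"
    have F': "?F \<in> Lip0K N w"
      using \<rho> by (intro Lip0K_comp[OF F] ne) auto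
    have cong: "Lip_norm M H = Lip_norm M H'" if "\<And>x. x \<in> mspace M \<Longrightarrow> H x = H' x"
      for H H' :: "'a \<Rightarrow> 'y"
      unfolding Lip_norm_def using that by (metis (no_types, lifting))
    \<comment> \<open>Composition with \<open>j\<close> gives one inequality between the norms,
      composition with \<open>\<rho>\<close> the other.\<close>
    have "Lip_norm M F = Lip_norm M (\<lambda>x. ?F (j x))"
      by (intro cong) (simp add: \<rho>j)
    also have "\<dots> \<le> Lip_norm N ?F"
      using Lip[OF F'] j(1) j_ne by (rule Lip_norm_comp_le)
    finally have F'1: "Lip_norm N ?F = 1"
      using Lip_norm_comp_le[OF Lip[OF F] \<rho>(1) ne] F1 by simp
    have "j p \<noteq> j q"
      using \<open>p \<noteq> q\<close> \<rho>j p q by metis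
    moreover have "norm (?F (j p) - ?F (j q)) > (1 - \<eta>) * mdist N (j p) (j q)"
      using big p q by (simp add: \<rho>j iso)
    moreover have "j p \<in> mspace N" "j q \<in> mspace N"
      using j(1) p q by auto
    ultimately obtain G r s where G: "G \<in> Lip0K N w" and r: "r \<in> mspace N" and s: "s \<in> mspace N"
      and "r \<noteq> s" and att: "norm (G r - G s) / mdist N r s = Lip_norm N G"
      and G1: "Lip_norm N G = 1"
      and GF: "Lip_norm N (\<lambda>x. G x - ?F x) < min \<epsilon> 1"
      and near: "(mdist N (j p) r + mdist N (j q) s) / mdist N (j p) (j q) < min \<epsilon> 1"
      using \<eta>[rule_format, OF F', of "j p" "j q"] F'1 by blast
    have LGF: "Lipschitz_continuous_map N euclidean_metric (\<lambda>x. G x - ?F x)"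
      by (intro Lipschitz_continuous_map_diff Lip[OF G] Lip[OF F'])
    \<comment> \<open>The extension \<open>?F\<close> takes the same value at both points, so the
      increment of \<open>G\<close> is that of \<open>G - ?F\<close>, whose norm is below
      \<open>1\<close>.\<close>
    have small: "norm (G x - G y) < mdist N x y"
      if "x \<in> mspace N" "y \<in> mspace N" "x \<noteq> y" "\<rho> x = z" "\<rho> y = z" for x y
    proof -
      have "norm (G x - G y) \<le> Lip_norm N (\<lambda>x. G x - ?F x) * mdist N x y"
        using norm_diff_le_Lip_norm[OF LGF that(1,2)] that by simp
      also have "\<dots> < 1 * mdist N x y"
        using GF mdist_gt_zero[OF that(3,1,2)] by (intro mult_strict_right_mono) auto
      finally show ?thesis by simp
    qed
    \<comment> \<open>No pair with a point outside the copy of \<open>M\<close> attains the norm.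
      From \<open>x\<close> in the copy, pass through \<open>w\<close>: the first leg has slope at
      most \<open>1\<close>, the second is strict by \<open>small\<close>, and the two lengths add
      up to the distance.\<close>
    have strict: "norm (G x - G y) < mdist N x y"
      if x: "x \<in> mspace N" and y: "y \<in> mspace N" "y \<notin> j ` mspace M" and "x \<noteq> y" for x y
    proof (cases "x \<in> j ` mspace M")
      case True
      then obtain a where a: "a \<in> mspace M" "x = j a" by auto
      \<comment> \<open>\<open>small\<close> is strict only for distinct points, so \<open>y\<close>
        has to be separated from \<open>w\<close>.\<close>
      have "w \<in> j ` mspace M"
        using j(2) funcset_mem[OF \<rho>(1) w] \<rho>(2) by auto
      then have "w \<noteq> y" using y by auto
      have "norm (G x - G y) \<le> norm (G x - G w) + norm (G w - G y)"
        using norm_triangle_ineq[of "G x - G w" "G w - G y"] by simp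
      also have "\<dots> < mdist N x w + mdist N w y"
        using norm_diff_le_Lip_norm[OF Lip[OF G] x w] G1
          small[OF w y(1) \<open>w \<noteq> y\<close> \<rho>(2) \<rho>z[OF y]] by simp
      also have "\<dots> = mdist N x y"
        using add a y by simp
      finally show ?thesis .
    next
      case False
      then show ?thesis
        using that by (intro small \<rho>z)
    qed
    have attained: "norm (G r - G s) = mdist N r s"
      using att G1 mdist_gt_zero[OF \<open>r \<noteq> s\<close> r s] by (simp add: field_simps)
    have "s \<in> j ` mspace M"
      using strict[OF r s _ \<open>r \<noteq> s\<close>] attained by auto
    moreover have "r \<in> j ` mspace M"
      using strict[OF s r _ \<open>r \<noteq> s\<close>[symmetric]] attained
      by (auto simp: norm_minus_commute mdist_commute)
    ultimately obtain a b where a: "a \<in> mspace M" "r = j a" and b: "b \<in> mspace M" "s = j b"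
      by auto
    let ?G = "\<lambda>x. G (j x)"
    have G': "?G \<in> Lip0K M z"
      using j by (intro Lip0K_comp[OF G] j_ne) auto
    have "a \<noteq> b"
      using \<open>r \<noteq> s\<close> a b by auto
    then have pos: "0 < mdist M a b"
      using a(1) b(1) by (rule mdist_gt_zero)
    have attained': "norm (?G a - ?G b) = mdist M a b"
      using attained a b iso by simp
    have "Lip_norm M ?G \<le> 1"
      using Lip_norm_comp_le[OF Lip[OF G] j(1) j_ne] G1 by simp
    \<comment> \<open>The pair at which \<open>G\<close> attains its norm survives the restriction,
      so the norm does not drop.\<close>
    moreover have "1 \<le> Lip_norm M ?G"
      using norm_diff_le_Lip_norm[OF Lip[OF G'] a(1) b(1)] pos attained' by simp
    ultimately have G'1: "Lip_norm M ?G = 1" by simp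
    have "Lip_norm M (\<lambda>x. ?G x - F x) = Lip_norm M (\<lambda>x. ?G x - ?F (j x))"
      by (intro cong) (simp add: \<rho>j)
    also have "\<dots> \<le> Lip_norm N (\<lambda>x. G x - ?F x)"
      using LGF j(1) j_ne by (rule Lip_norm_comp_le)
    finally have GF': "Lip_norm M (\<lambda>x. ?G x - F x) < \<epsilon>"
      using GF by simp
    have "(mdist M p a + mdist M q b) / mdist M p q < \<epsilon>"
      using near a b p q by (simp add: iso)
    then show "\<exists>G \<in> (Lip0K M z :: ('a \<Rightarrow> 'y) set). \<exists>r \<in> mspace M. \<exists>s \<in> mspace M. r \<noteq> s \<and>
        norm (G r - G s) / mdist M r s = Lip_norm M G \<and> Lip_norm M G = 1 \<and>
        Lip_norm M (\<lambda>x. G x - F x) < \<epsilon> \<and>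
        (mdist M p r + mdist M q s) / mdist M p q < \<epsilon>"
      using G' a(1) b(1) \<open>a \<noteq> b\<close> attained' pos G'1 GF'
      by (intro bexI[of _ ?G] bexI[of _ a] bexI[of _ b]) auto
  qed
qed

theorem proposition2p6:
  fixes M1 :: "'a metric" and M2 :: "'b metric" and z1 :: 'a and z2 :: 'b
  assumes "mcomplete_of M1" and "z1 \<in> mspace M1"
    and "mcomplete_of M2" and "z2 \<in> mspace M2"
    and "Lip_BPB_compact (metric_sum M1 z1 M2 z2) (Inl z1) TYPE('y::banach)"
  shows "Lip_BPB_compact M1 z1 TYPE('y) \<and> Lip_BPB_compact M2 z2 TYPE('y)"
proof -
  note z = \<open>z1 \<in> mspace M1\<close> \<open>z2 \<in> mspace M2\<close>
  \<comment> \<open>These terms arise from the mixed clauses of \<open>sum_dist\<close> at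
    \<open>Inl z1\<close> and from pairs that a retraction collapses.\<close>
  have "mdist M1 z1 z1 = 0" "mdist M2 z2 z2 = 0"
    using z by simp_all
  note sum_simps = this mspace_metric_sum[OF z] mdist_metric_sum[OF z] sum_carrier_def
  have "Lip_BPB_compact M1 z1 TYPE('y)"
    by (rule Lip_BPB_compact_retract[where N = "metric_sum M1 z1 M2 z2" and w = "Inl z1"
          and j = Inl and \<rho> = "case_sum (\<lambda>x. x) (\<lambda>_. z1)"])
      (use z assms(5) in \<open>auto simp: sum_simps\<close>)
  moreover have "Lip_BPB_compact M2 z2 TYPE('y)"
    \<comment> \<open>\<open>Inr z2\<close> is not in the carrier, so the embedding of the second
      summand has to send \<open>z2\<close> to \<open>Inl z1\<close>.\<close>
    by (rule Lip_BPB_compact_retract[where N = "metric_sum M1 z1 M2 z2" and w = "Inl z1"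
          and j = "\<lambda>y. if y = z2 then Inl z1 else Inr y" and \<rho> = "case_sum (\<lambda>_. z2) (\<lambda>y. y)"])
      (use z assms(5) in \<open>auto simp: sum_simps mdist_commute image_iff split: if_splits\<close>)
  ultimately show ?thesis ..
qed

end
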